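(* Consider the biobjective integer program "$\min$" $\{z(x)=(z_1(x),z_2(x))^T : x\in\mathcal{X}\subseteq\mathbb{Z}^n\}$ with integer-valued objectives $z_1,z_2$, and let $N$ be its number of nondominated points. Let $d\in\mathbb{R}^2_+\setminus\{0\}$ (i.e. $d\ge 0$ componentwise, $d\neq 0$) and $0<\epsilon<1$. Then, without using the elimination rule, the upper and lower bounds on the number of mixed integer programs solved through Algorithm 1 (described in the context) are $4N-3$ and $2N+1$, respectively; that is, the number $M$ of mixed integer programs solved satisfies $$2N+1\le M\le 4N-3.$$
   Context: Problem. $\mathcal{X}\subseteq\mathbb{Z}^n$ is the feasible set, $z_1,z_2:\mathcal{X}\to\mathbb{Z}$ are integer-valued, and $\mathcal{Z}=\{z(x):x\in\mathcal{X}\}$. It is implicitly assumed that $\mathcal{X}\ne\emptyset$ and that the two lexicographic problems below have optimal solutions. For vectors in $\mathbb{R}^2$, $\le$ is componentwise. A point $z(x)\in\mathcal{Z}$ is nondominated if there is no $x'\in\mathcal{X}$ with $z(x')\le z(x)$ and $z(x')\ne z(x)$. $\text{lexmin}\{z_i(x),z_j(x): x\in\mathcal{X}\}$ means: first solve $\min\{z_i(x):x\in\mathcal{X}\}$ with optimal solution $x'$, then solve $\min\{z_j(x):x\in\mathcal{X},\ z_i(x)=z_i(x')\}$. Thus each lexmin counts as two integer programs. A box is given by three points $s,p,t\in\mathbb{R}^2$ and is denoted $b(s,p,t)$ (as a set it is $\{y\in\mathbb{R}^2: s_1\le y_1\le p_1,\ s_2\le y_2\le t_2\}$). For a box $b=b(s^b,p^b,t^b)$,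 problem $R(b,d)$ is $$\min\{\alpha : x\in\mathcal{X},\ \alpha\in\mathbb{R},\ z(x)\le s^b+\alpha d,\ z_1(x)\le p_1^b-\epsilon,\ z_2(x)\le t_2^b-\epsilon\}.$$ Problem $P_1(x^b)$ is $\min\{z_2(x):x\in\mathcal{X},\ z_1(x)=z_1(x^b)\}$; problem $P_2(x^b)$ is $\min\{z_1(x):x\in\mathcal{X},\ z_2(x)=z_2(x^b)\}$. Algorithm 1 without the elimination rule. Fix the direction $d$ and $0<\epsilon<1$. Initialization: let $t^0$ be the objective vector of a solution of $\text{lexmin}\{z_1(x),z_2(x):x\in\mathcal{X}\}$ and $p^0$ that of $\text{lexmin}\{z_2(x),z_1(x):x\in\mathcal{X}\}$. Set the output list $\mathcal{N}=\{t^0,p^0\}$, $s^0=(t^0_1,p^0_2)^T$, $\mathcal{B}=\{b(s^0,p^0,t^0)\}$. Main loop: while $\mathcal{B}\neq\emptyset$, pick a box $b=b(s^b,p^b,t^b)\in\mathcal{B}$ and solve $R(b,d)$. If $R(b,d)$ is feasible, let $(\alpha^b,x^b)$ be an optimal solution and do the following. (1) Set $y^b=s^b+\alpha^b d$ and $n^b=z(x^b)$. (2) If $y^b_1=n^b_1$, solve $P_1(x^b)$, let $x^1$ be an optimal solution and set $n^1=z(x^1)$; otherwise set $n^1=n^b$. (3) If $y^b_2=n^b_2$, solve $P_2(x^b)$, let $x^2$ be an optimal solution and set $n^2=z(x^2)$; otherwise set $n^2=n^b$. (4) If $n^1_2<n^b_2$, add $n^1$ to $\mathcal{N}$. If $n^2_1<n^b_1$,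 add $n^2$ to $\mathcal{N}$. If $n^1_2\ge n^b_2$ and $n^2_1\ge n^b_1$, add $n^b$ to $\mathcal{N}$. (5) Set $s^1=(n^1_1,p^b_2)^T$ and $s^2=(t^b_1,n^2_2)^T$. (6) Add both boxes $b(s^1,p^b,n^1)$ and $b(s^2,n^2,t^b)$ to $\mathcal{B}$. (The full algorithm instead adds the first only if $p^b_1-s^1_1>1$ and $n^1_2-s^1_2>1$, and the second only if $n^2_1-s^2_1>1$ and $t^b_2-s^2_2>1$; this is the elimination rule, which is not used here.) In all cases (feasible or not), finally remove $b(s^b,p^b,t^b)$ from $\mathcal{B}$. When $\mathcal{B}$ is empty, return $\mathcal{N}$. Counting: the programs counted are the four problems of the two lexmin solves, every $R(b,d)$ solved (feasible or infeasible), and every $P_1(x^b)$ and $P_2(x^b)$ solved.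
   Formalization: The upper bound 4N-3 is stated only for N ≥ 2 (for N = 1 one always has M = 5 > 1); the lower bound 2N+1 is stated only if both components of d are positive or N ≤ 2 (if d has a zero component and N ≥ 3, then M = 5 < 2N+1). *)

theory Defs
  imports "HOL-Analysis.Analysis"
begin

text \<open>
  A biobjective integer program is given by its feasible set \<open>X\<close> and by \<open>z x = (z1 x, z2 x)\<close>;
  only the values of \<open>z\<close> on \<open>X\<close> are ever used. On \<^typ>\<open>int^2\<close> and \<^typ>\<open>real^2\<close> the order \<open>\<le>\<close> is
  componentwise.
\<close>

definition nondominated_points :: "(int^'n) set \<Rightarrow> (int^'n \<Rightarrow> int^2) \<Rightarrow> (int^2) set" where
  "nondominated_points X z =
     {z x | x. x \<in> X \<and> \<not> (\<exists>x'\<in>X. z x' \<le> z x \<and> z x' \<noteq> z x)}"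

definition objective :: "(int^'n \<Rightarrow> int^2) \<Rightarrow> int^'n \<Rightarrow> real^2" where
  "objective z x = (\<chi> i. real_of_int (z x $ i))"

definition lexmin_solution ::
  "(int^'n) set \<Rightarrow> (int^'n \<Rightarrow> int^2) \<Rightarrow> 2 \<Rightarrow> 2 \<Rightarrow> int^'n \<Rightarrow> bool" where
  "lexmin_solution X z i j x \<longleftrightarrow>
     (\<exists>x'. is_arg_min (\<lambda>u. z u $ i) (\<lambda>u. u \<in> X) x' \<and>
           is_arg_min (\<lambda>u. z u $ j) (\<lambda>u. u \<in> X \<and> z u $ i = z x' $ i) x)"

datatype box = Box (box_s: "real^2") (box_p: "real^2") (box_t: "real^2")

definition R_feasible ::
  "(int^'n) set \<Rightarrow> (int^'n \<Rightarrow> int^2) \<Rightarrow> real^2 \<Rightarrow> real \<Rightarrow> box \<Rightarrow> real \<times> (int^'n) \<Rightarrow> bool" where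
  "R_feasible X z d \<epsilon> b = (\<lambda>(\<alpha>, x). x \<in> X \<and>
     objective z x \<le> box_s b + \<alpha> *\<^sub>R d \<and>
     objective z x $ 1 \<le> box_p b $ 1 - \<epsilon> \<and>
     objective z x $ 2 \<le> box_t b $ 2 - \<epsilon>)"

definition R_optimal ::
  "(int^'n) set \<Rightarrow> (int^'n \<Rightarrow> int^2) \<Rightarrow> real^2 \<Rightarrow> real \<Rightarrow> box \<Rightarrow> real \<Rightarrow> int^'n \<Rightarrow> bool" where
  "R_optimal X z d \<epsilon> b \<alpha> x \<longleftrightarrow> is_arg_min fst (R_feasible X z d \<epsilon> b) (\<alpha>, x)"

definition P1_optimal ::
  "(int^'n) set \<Rightarrow> (int^'n \<Rightarrow> int^2) \<Rightarrow> int^'n \<Rightarrow> int^'n \<Rightarrow> bool" where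
  "P1_optimal X z xb x \<longleftrightarrow>
     is_arg_min (\<lambda>u. z u $ 2) (\<lambda>u. u \<in> X \<and> z u $ 1 = z xb $ 1) x"

definition P2_optimal ::
  "(int^'n) set \<Rightarrow> (int^'n \<Rightarrow> int^2) \<Rightarrow> int^'n \<Rightarrow> int^'n \<Rightarrow> bool" where
  "P2_optimal X z xb x \<longleftrightarrow>
     is_arg_min (\<lambda>u. z u $ 1) (\<lambda>u. u \<in> X \<and> z u $ 2 = z xb $ 2) x"

record alg_state =
  found :: "(real^2) set"
  boxes :: "box set"
  solved :: nat   \<comment> \<open>number of programs solved so far\<close>

text \<open>The counter starts at 4: each of the two lexicographic problems is two programs.\<close>

inductive initial_state :: "(int^'n) set \<Rightarrow> (int^'n \<Rightarrow> int^2) \<Rightarrow> alg_state \<Rightarrow> bool"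
  for X z where
  "initial_state X z
     \<lparr>found = {t0, p0}, boxes = {Box (vector [t0 $ 1, p0 $ 2]) p0 t0}, solved = 4\<rparr>"
  if "lexmin_solution X z 1 2 x" and "t0 = objective z x"
    and "lexmin_solution X z 2 1 x'" and "p0 = objective z x'"

text \<open>
  One pass through the main loop, without the elimination rule. The choice of the box and of the
  optimal solutions is left open, so the step is a relation.
\<close>

inductive alg_step ::
  "(int^'n) set \<Rightarrow> (int^'n \<Rightarrow> int^2) \<Rightarrow> real^2 \<Rightarrow> real \<Rightarrow> alg_state \<Rightarrow> alg_state \<Rightarrow> bool"
  for X z d \<epsilon> where
  infeasible:
  "alg_step X z d \<epsilon> \<lparr>found = F, boxes = B, solved = m\<rparr>
     \<lparr>found = F, boxes = B - {b}, solved = m + 1\<rparr>"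
  if "b \<in> B" and "\<nexists>q. R_feasible X z d \<epsilon> b q"
| feasible:
  "alg_step X z d \<epsilon> \<lparr>found = F, boxes = B, solved = m\<rparr>
     \<lparr>found = F \<union> (if n1 $ 2 < nb $ 2 then {n1} else {})
                \<union> (if n2 $ 1 < nb $ 1 then {n2} else {})
                \<union> (if n1 $ 2 \<ge> nb $ 2 \<and> n2 $ 1 \<ge> nb $ 1 then {nb} else {}),
      boxes = (B \<union> {Box s1 p n1, Box s2 n2 t}) - {b},
      solved = m + 1 + (if y $ 1 = nb $ 1 then 1 else 0) + (if y $ 2 = nb $ 2 then 1 else 0)\<rparr>"
  if "b \<in> B" and "b = Box s p t"
    and "R_optimal X z d \<epsilon> b \<alpha> xb"
    and "y = s + \<alpha> *\<^sub>R d" and "nb = objective z xb"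
    and "if y $ 1 = nb $ 1 then \<exists>x1. P1_optimal X z xb x1 \<and> n1 = objective z x1 else n1 = nb"
    and "if y $ 2 = nb $ 2 then \<exists>x2. P2_optimal X z xb x2 \<and> n2 = objective z x2 else n2 = nb"
    and "s1 = vector [n1 $ 1, p $ 2]" and "s2 = vector [t $ 1, n2 $ 2]"

text \<open>
  A maximal execution as an infinite sequence of states: when no step is possible, as is the case
  when no boxes are left, the last state is repeated forever. Termination is not presupposed, and
  neither is the existence of optimal solutions during the loop; hence the number of programs
  solved is an extended natural number, infinite for an execution that never stops.
\<close>

definition execution ::
  "(int^'n) set \<Rightarrow> (int^'n \<Rightarrow> int^2) \<Rightarrow> real^2 \<Rightarrow> real \<Rightarrow> (nat \<Rightarrow> alg_state) \<Rightarrow> bool" where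
  "execution X z d \<epsilon> \<sigma> \<longleftrightarrow> initial_state X z (\<sigma> 0) \<and>
     (\<forall>k. if \<exists>S. alg_step X z d \<epsilon> (\<sigma> k) S then alg_step X z d \<epsilon> (\<sigma> k) (\<sigma> (Suc k))
          else \<sigma> (Suc k) = \<sigma> k)"

definition programs_solved :: "(nat \<Rightarrow> alg_state) \<Rightarrow> enat" where
  "programs_solved \<sigma> = (SUP k. enat (solved (\<sigma> k)))"

end

theory Submission
  imports Defs
begin

text \<open>
  Call the set of outcomes with \<open>z\<^sub>1 < p\<^sub>1\<close> and \<open>z\<^sub>2 < t\<^sub>2\<close> the region of a box. If the program of
  a box is feasible, the regions of its two children are disjoint subsets of its region, and the only
  nondominated points they can miss are \<open>n\<^sup>1\<close>, if the first subproblem was solved, and \<open>n\<^sup>2\<close>, if the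
  second was; at least one is missed. So \<open>k\<close> nondominated points in the region of a box cause at
  most \<open>4 k + 1\<close> and, if \<open>d > 0\<close>, at least \<open>2 k + 1\<close> programs. The initial region contains all
  nondominated points but \<open>t\<^sup>0\<close> and \<open>p\<^sup>0\<close>, so that \<open>k = N - 2\<close>, and 4 programs were solved before.
\<close>

section \<open>Efficient outcomes in \<open>real^2\<close>\<close>

lemma le_vec2_iff: "(x :: real^2) \<le> y \<longleftrightarrow> x $ 1 \<le> y $ 1 \<and> x $ 2 \<le> y $ 2"
  by (simp add: less_eq_vec_def forall_2)

lemma eq_vec2_iff: "(x :: 'a^2) = y \<longleftrightarrow> x $ 1 = y $ 1 \<and> x $ 2 = y $ 2"
  by (simp add: vec_eq_iff forall_2)

definition efficient :: "(real^2) set \<Rightarrow> (real^2) set" where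
  "efficient Y = {q \<in> Y. \<forall>y\<in>Y. y \<le> q \<longrightarrow> y = q}"

lemma objective_le_iff [simp]: "objective z x \<le> objective z x' \<longleftrightarrow> z x \<le> z x'"
  by (simp add: objective_def less_eq_vec_def)

lemma objective_eq_iff [simp]: "objective z x = objective z x' \<longleftrightarrow> z x = z x'"
  by (simp add: objective_def vec_eq_iff)

lemma objective_nth [simp]: "objective z x $ i = of_int (z x $ i)"
  by (simp add: objective_def)

text \<open>The cast from \<open>int^2\<close> to \<open>real^2\<close> is injective and preserves
  and reflects the order, so it maps the nondominated points bijectively onto the efficient
  outcomes.\<close>

lemma card_nondominated_points:
  "card (nondominated_points X z) = card (efficient (objective z ` X))"
proof -
  let ?r = "\<lambda>v :: int^2. (\<chi> i. real_of_int (v $ i)) :: real^2"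
  have "efficient (objective z ` X) = objective z ` {x \<in> X. \<forall>x'\<in>X. z x' \<le> z x \<longrightarrow> z x' = z x}"
    by (auto simp: efficient_def)
  also have "\<dots> = ?r ` z ` {x \<in> X. \<forall>x'\<in>X. z x' \<le> z x \<longrightarrow> z x' = z x}"
    by (simp add: image_image objective_def)
  also have "z ` {x \<in> X. \<forall>x'\<in>X. z x' \<le> z x \<longrightarrow> z x' = z x} = nondominated_points X z"
    by (auto simp: nondominated_points_def)
  finally have "efficient (objective z ` X) = ?r ` nondominated_points X z" .
  moreover have "inj ?r"
    by (auto simp: inj_def vec_eq_iff)
  ultimately show ?thesis
    by (metis card_image inj_on_subset subset_UNIV)
qed

section \<open>Integral outcome sets with two lexicographic minima, and boxes over them\<close>

locale outcome_set =
  fixes Y :: "(real^2) set" and t\<^sub>0 p\<^sub>0 :: "real^2"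
  assumes Ints: "y \<in> Y \<Longrightarrow> y $ i \<in> \<int>"
    and t0: "t\<^sub>0 \<in> Y" "y \<in> Y \<Longrightarrow> t\<^sub>0 $ 1 \<le> y $ 1"
      "y \<in> Y \<Longrightarrow> y $ 1 = t\<^sub>0 $ 1 \<Longrightarrow> t\<^sub>0 $ 2 \<le> y $ 2"
    and p0: "p\<^sub>0 \<in> Y" "y \<in> Y \<Longrightarrow> p\<^sub>0 $ 2 \<le> y $ 2"
      "y \<in> Y \<Longrightarrow> y $ 2 = p\<^sub>0 $ 2 \<Longrightarrow> p\<^sub>0 $ 1 \<le> y $ 1"
begin

text \<open>The two minima bound the coordinates from below, so only the integer points of a
  rectangle remain; \<open>Y\<close> itself may be infinite.\<close>

lemma finite_below: "finite {y \<in> Y. y \<le> c}"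
proof (rule finite_subset)
  let ?A = "{k \<in> \<int>. t\<^sub>0 $ 1 \<le> k \<and> k \<le> c $ 1} \<times> {k \<in> \<int>. p\<^sub>0 $ 2 \<le> k \<and> k \<le> c $ 2}"
  show "finite ((\<lambda>(a, b). vector [a, b] :: real^2) ` ?A)"
    by (intro finite_imageI finite_cartesian_product finite_int_segment)
  show "{y \<in> Y. y \<le> c} \<subseteq> (\<lambda>(a, b). vector [a, b]) ` ?A"
  proof
    fix y assume "y \<in> {y \<in> Y. y \<le> c}"
    then have "(y $ 1, y $ 2) \<in> ?A" "y = vector [y $ 1, y $ 2]"
      by (auto simp: le_vec2_iff eq_vec2_iff intro: Ints t0 p0)
    then show "y \<in> (\<lambda>(a, b). vector [a, b]) ` ?A" by (force intro: rev_image_eqI)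
  qed
qed

lemma efficient_below:
  assumes "y \<in> Y"
  obtains q where "q \<in> efficient Y" "q \<le> y"
proof -
  obtain q where q: "q \<in> Y" "q \<le> y" "\<And>w. w \<in> Y \<Longrightarrow> w \<le> y \<Longrightarrow> w \<le> q \<Longrightarrow> q = w"
    using finite_has_minimal2[OF finite_below, of y y] assms by (metis (lifting) mem_Collect_eq order_refl)
  then have "\<forall>w\<in>Y. w \<le> q \<longrightarrow> w = q"
    by (metis order_trans)
  with q(1) have "q \<in> efficient Y"
    by (simp add: efficient_def)
  with q that show thesis by blast
qed

text \<open>An outcome \<open>q\<close> with \<open>q $ 2\<close> above \<open>t\<^sub>0 $ 2\<close>
  is dominated by \<open>t\<^sub>0\<close>, and one with \<open>q $ 1\<close> above
  \<open>p\<^sub>0 $ 1\<close> by \<open>p\<^sub>0\<close>.\<close>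

lemma finite_efficient: "finite (efficient Y)"
proof (rule finite_subset)
  show "finite {y \<in> Y. y \<le> vector [p\<^sub>0 $ 1, t\<^sub>0 $ 2]}" by (rule finite_below)
  have "q $ 1 \<le> p\<^sub>0 $ 1 \<and> q $ 2 \<le> t\<^sub>0 $ 2" if "q \<in> efficient Y" for q
  proof -
    have q: "q \<in> Y" "t\<^sub>0 \<le> q \<Longrightarrow> t\<^sub>0 = q" "p\<^sub>0 \<le> q \<Longrightarrow> p\<^sub>0 = q"
      using that t0(1) p0(1) by (auto simp: efficient_def)
    then show ?thesis
      using t0(2)[OF q(1)] p0(2)[OF q(1)] by (force simp: le_vec2_iff)
  qed
  then show "efficient Y \<subseteq> {y \<in> Y. y \<le> vector [p\<^sub>0 $ 1, t\<^sub>0 $ 2]}"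
    by (auto simp: le_vec2_iff efficient_def)
qed

lemma t0_efficient: "t\<^sub>0 \<in> efficient Y"
  using t0 by (fastforce simp: efficient_def le_vec2_iff eq_vec2_iff)

lemma p0_efficient: "p\<^sub>0 \<in> efficient Y"
  using p0 by (fastforce simp: efficient_def le_vec2_iff eq_vec2_iff)

text \<open>As objectives are integral and \<open>0 < \<epsilon> < 1\<close>, the bounds \<open>z\<^sub>1 \<le> p\<^sub>1 - \<epsilon>\<close> and \<open>z\<^sub>2 \<le> t\<^sub>2 - \<epsilon>\<close> of the
  program for a box say just that the outcome is in this set.\<close>

definition region :: "box \<Rightarrow> (real^2) set" where
  "region b = {y \<in> Y. y $ 1 < box_p b $ 1 \<and> y $ 2 < box_t b $ 2}"

text \<open>\<open>box_p b\<close> and \<open>box_t b\<close> are kept in \<open>Y\<close> for their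
  integrality. The last clause forces \<open>\<alpha> *\<^sub>R d\<close> to be positive in both
  coordinates at every feasible solution.\<close>

definition regular :: "box \<Rightarrow> bool" where
  "regular b \<longleftrightarrow> box_p b \<in> Y \<and> box_t b \<in> Y \<and> box_s b = vector [box_t b $ 1, box_p b $ 2] \<and>
     (\<forall>y\<in>region b. box_s b $ 1 < y $ 1 \<and> box_s b $ 2 < y $ 2)"

definition count :: "box \<Rightarrow> nat" where
  "count b = card (efficient Y \<inter> region b)"

definition initial_box :: box where
  "initial_box = Box (vector [t\<^sub>0 $ 1, p\<^sub>0 $ 2]) p\<^sub>0 t\<^sub>0"

lemma finite_region: "finite (region b)"
  by (rule finite_subset[OF _ finite_below[of "vector [box_p b $ 1, box_t b $ 2]"]])
    (auto simp: region_def le_vec2_iff)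

lemma regular_initial_box: "regular initial_box"
proof -
  have "t\<^sub>0 $ 1 < y $ 1 \<and> p\<^sub>0 $ 2 < y $ 2" if "y \<in> Y" "y $ 1 < p\<^sub>0 $ 1" "y $ 2 < t\<^sub>0 $ 2" for y
    using t0(2,3)[OF that(1)] p0(2,3)[OF that(1)] that by force
  then show ?thesis
    by (auto simp: regular_def initial_box_def region_def t0 p0)
qed

lemma efficient_subset_initial_region:
  "efficient Y \<subseteq> insert t\<^sub>0 (insert p\<^sub>0 (efficient Y \<inter> region initial_box))"
proof
  fix q assume q: "q \<in> efficient Y"
  then have "q \<in> Y" "t\<^sub>0 \<le> q \<Longrightarrow> t\<^sub>0 = q" "p\<^sub>0 \<le> q \<Longrightarrow> p\<^sub>0 = q"
    using t0(1) p0(1) by (auto simp: efficient_def)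
  then show "q \<in> insert t\<^sub>0 (insert p\<^sub>0 (efficient Y \<inter> region initial_box))"
    using t0(2)[of q] p0(2)[of q] q by (force simp: le_vec2_iff region_def initial_box_def)
qed

text \<open>If the first coordinates agree, the two lexicographic minima coincide and the initial
  region is empty, which leaves a single efficient point.\<close>

lemma initial_box_nondegenerate:
  assumes "2 \<le> card (efficient Y)"
  shows "t\<^sub>0 $ 1 < p\<^sub>0 $ 1"
proof (rule ccontr)
  assume "\<not> t\<^sub>0 $ 1 < p\<^sub>0 $ 1"
  with t0(2)[OF p0(1)] have eq: "p\<^sub>0 $ 1 = t\<^sub>0 $ 1" by simp
  have "p\<^sub>0 = t\<^sub>0"
    using t0(3)[OF p0(1) eq] p0(2)[OF t0(1)] eq by (simp add: eq_vec2_iff)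
  moreover have "region initial_box = {}"
    using t0(2) eq by (force simp: region_def initial_box_def)
  ultimately have "efficient Y \<subseteq> {t\<^sub>0}"
    using efficient_subset_initial_region by auto
  then have "card (efficient Y) \<le> 1"
    using card_mono[of "{t\<^sub>0}"] by auto
  with assms show False by simp
qed

lemma count_initial_box:
  assumes "2 \<le> card (efficient Y)"
  shows "count initial_box + 2 = card (efficient Y)"
proof -
  let ?A = "efficient Y \<inter> region initial_box"
  have "t\<^sub>0 \<noteq> p\<^sub>0" using initial_box_nondegenerate[OF assms] by auto
  moreover have "t\<^sub>0 \<notin> ?A" "p\<^sub>0 \<notin> ?A"
    by (auto simp: region_def initial_box_def)
  moreover have "finite ?A" using finite_efficient by simp
  ultimately have "card (insert t\<^sub>0 (insert p\<^sub>0 ?A)) = card ?A + 2" by simp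
  moreover have "insert t\<^sub>0 (insert p\<^sub>0 ?A) = efficient Y"
    using efficient_subset_initial_region t0_efficient p0_efficient by blast
  ultimately show ?thesis by (simp add: count_def)
qed

end

text \<open>The geometry of a feasible iteration: \<open>n\<close> is the outcome of the program for the box \<open>b\<close>, its
  optimality entering only through the fact that the region of \<open>b\<close> has no point strictly below \<open>y\<close>
  in both coordinates; \<open>u\<close> and \<open>v\<close> are the points called \<open>n\<^sup>1\<close> and \<open>n\<^sup>2\<close> in the algorithm.\<close>

locale box_split = outcome_set +
  fixes b :: box and y n u v :: "real^2"
  assumes regular: "regular b"
    and n: "n \<in> region b" "n \<le> y"
    and none_below: "q \<in> region b \<Longrightarrow> \<not> (q $ 1 < y $ 1 \<and> q $ 2 < y $ 2)"
    and u: "u \<in> Y" "u $ 1 = n $ 1" "u $ 2 \<le> n $ 2" "y $ 1 \<noteq> n $ 1 \<Longrightarrow> u = n"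
      "w \<in> Y \<Longrightarrow> y $ 1 = n $ 1 \<Longrightarrow> w $ 1 = n $ 1 \<Longrightarrow> u $ 2 \<le> w $ 2"
    and v: "v \<in> Y" "v $ 2 = n $ 2" "v $ 1 \<le> n $ 1" "y $ 2 \<noteq> n $ 2 \<Longrightarrow> v = n"
      "w \<in> Y \<Longrightarrow> y $ 2 = n $ 2 \<Longrightarrow> w $ 2 = n $ 2 \<Longrightarrow> v $ 1 \<le> w $ 1"
begin

section \<open>The children of a box: regions and counts\<close>

definition right_box :: box where
  "right_box = Box (vector [u $ 1, box_p b $ 2]) (box_p b) u"

definition left_box :: box where
  "left_box = Box (vector [box_t b $ 1, v $ 2]) v (box_t b)"

lemma tight: "y $ 1 = n $ 1 \<or> y $ 2 = n $ 2"
  using none_below[OF n(1)] n(2) by (auto simp: le_vec2_iff)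

lemma uv_region: "u \<in> region b" "v \<in> region b"
  using n(1) u(1-3) v(1-3) by (auto simp: region_def)

text \<open>Since \<open>w $ 2 < u $ 2 \<le> n $ 2 \<le> y $ 2\<close>, the point \<open>w\<close>
  is strictly below \<open>y\<close> unless \<open>n $ 1 \<le> y $ 1 \<le> w $ 1\<close>. Equality
  throughout would put \<open>w\<close> in the column in which \<open>u\<close> is lowest.\<close>

lemma right_region:
  assumes "w \<in> region right_box"
  shows "w \<in> region b" "n $ 1 < w $ 1"
proof -
  have w: "w \<in> Y" "w $ 1 < box_p b $ 1" "w $ 2 < u $ 2"
    using assms by (auto simp: region_def right_box_def)
  show wb: "w \<in> region b"
    using w uv_region(1) by (auto simp: region_def)
  have "y $ 1 \<le> w $ 1"
    using none_below[OF wb] w u(3) n(2) by (force simp: le_vec2_iff)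
  then show "n $ 1 < w $ 1"
    using u(5)[OF w(1)] w(3) n(2) by (force simp: le_vec2_iff)
qed

lemma left_region:
  assumes "w \<in> region left_box"
  shows "w \<in> region b" "n $ 2 < w $ 2"
proof -
  have w: "w \<in> Y" "w $ 2 < box_t b $ 2" "w $ 1 < v $ 1"
    using assms by (auto simp: region_def left_box_def)
  show wb: "w \<in> region b"
    using w uv_region(2) by (auto simp: region_def)
  have "y $ 2 \<le> w $ 2"
    using none_below[OF wb] w v(3) n(2) by (force simp: le_vec2_iff)
  then show "n $ 2 < w $ 2"
    using v(5)[OF w(1)] w(3) n(2) by (force simp: le_vec2_iff)
qed

lemma regular_right: "regular right_box"
  using regular right_region u(1,2)
  by (auto simp: regular_def right_box_def)

lemma regular_left: "regular left_box"
  using regular left_region v(1,2)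
  by (auto simp: regular_def left_box_def)

text \<open>The intervals from \<open>t $ 1\<close> to \<open>p $ 1\<close> of the left and the
  right child lie side by side in that of \<open>b\<close>, and both have positive length.\<close>

lemma interval_order:
  "box_t b $ 1 < v $ 1" "v $ 1 \<le> u $ 1" "u $ 1 < box_p b $ 1"
  using regular uv_region u(2) v(3) by (auto simp: regular_def region_def)

lemma regions_disjoint: "region right_box \<inter> region left_box = {}"
  using right_region left_region v(3)
  by (fastforce simp: region_def left_box_def)

lemma count_children: "count right_box + count left_box =
    card (efficient Y \<inter> (region right_box \<union> region left_box))"
  unfolding count_def Int_Un_distrib
  by (rule card_Un_disjoint[symmetric]) (use regions_disjoint finite_region in auto)

text \<open>The outcome \<open>n\<close> may be dominated, but an efficient point below it is in the
  region of \<open>b\<close> and in neither child, whose points exceed \<open>n\<close> in a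
  coordinate.\<close>

lemma count_children_less: "count right_box + count left_box < count b"
proof -
  have "n \<in> Y" using n(1) by (simp add: region_def)
  then obtain q where q: "q \<in> efficient Y" "q \<le> n" by (rule efficient_below)
  then have "q \<in> region b"
    using n(1) by (auto simp: region_def le_vec2_iff efficient_def)
  moreover have "q \<notin> region right_box \<union> region left_box"
    using q(2) right_region(2) left_region(2) by (force simp: le_vec2_iff)
  ultimately have "efficient Y \<inter> (region right_box \<union> region left_box) \<subset> efficient Y \<inter> region b"
    using q(1) right_region(1) left_region(1) by blast
  then show ?thesis
    unfolding count_children unfolding count_def by (intro psubset_card_mono) (use finite_region in auto)
qed

lemma efficient_not_in_children:
  assumes "q \<in> efficient Y" "q \<in> region b" "q \<notin> region right_box" "q \<notin> region left_box"
  shows "y $ 1 = n $ 1 \<and> q = u \<or> y $ 2 = n $ 2 \<and> q = v"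
proof -
  have q: "q \<in> Y" "u $ 2 \<le> q $ 2" "v $ 1 \<le> q $ 1"
    using assms by (auto simp: region_def right_box_def left_box_def)
  have eff: "w \<in> Y \<Longrightarrow> w \<le> q \<Longrightarrow> q = w" for w
    using assms(1) by (auto simp: efficient_def)
  consider "y $ 1 \<le> q $ 1" | "y $ 2 \<le> q $ 2"
    using none_below[OF assms(2)] by force
  then have "q = u \<or> q = v"
  proof cases
    case 1
    then have "u \<le> q" using n(2) u(2) q(2) by (auto simp: le_vec2_iff)
    then show ?thesis using eff u(1) by blast
  next
    case 2
    then have "v \<le> q" using n(2) v(2) q(3) by (auto simp: le_vec2_iff)
    then show ?thesis using eff v(1) by blast
  qed
  \<comment> \<open>If \<open>q = u\<close> but the first subproblem was not solved, then
    \<open>q = n\<close>. By \<open>tight\<close> the second one was solved, and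
    \<open>v \<le> n\<close> forces \<open>q = v\<close>. The other case is symmetric.\<close>
  moreover have "u \<le> n" "v \<le> n"
    using u(2,3) v(2,3) by (auto simp: le_vec2_iff)
  ultimately show ?thesis
    using tight eff[OF u(1)] eff[OF v(1)] u(4) v(4) by metis
qed

lemma count_le_children:
  "count b \<le> count right_box + count left_box
     + (if y $ 1 = n $ 1 then 1 else 0) + (if y $ 2 = n $ 2 then 1 else 0)"
proof -
  let ?C = "efficient Y \<inter> (region right_box \<union> region left_box)"
  let ?U = "if y $ 1 = n $ 1 then {u} else {}" and ?V = "if y $ 2 = n $ 2 then {v} else {}"
  have "efficient Y \<inter> region b \<subseteq> ?C \<union> ?U \<union> ?V"
    using efficient_not_in_children by auto
  then have "count b \<le> card (?C \<union> ?U \<union> ?V)"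
    unfolding count_def by (intro card_mono) (auto simp: finite_region)
  also have "\<dots> \<le> card ?C + card ?U + card ?V"
    by (meson card_Un_le add_le_mono1 order_trans)
  finally show ?thesis by (simp add: count_children split: if_splits)
qed

end

section \<open>Reduction of the programs to regions of boxes, and their solvability\<close>

lemma Ints_le_diff_iff:
  fixes a b \<epsilon> :: real
  assumes "a \<in> \<int>" "b \<in> \<int>" "0 < \<epsilon>" "\<epsilon> < 1"
  shows "a \<le> b - \<epsilon> \<longleftrightarrow> a < b"
proof -
  from assms(1,2) obtain i j where "a = of_int i" "b = of_int j" by (auto elim!: Ints_cases)
  moreover have "real_of_int i \<le> of_int j - 1" if "i < j" using that by linarith
  ultimately show ?thesis using assms(3,4) by auto
qed

lemma lexmin_solution_iff:
  "lexmin_solution X z i j x \<longleftrightarrow> x \<in> X \<and> (\<forall>u\<in>X. z x $ i \<le> z u $ i) \<and>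
     (\<forall>u\<in>X. z u $ i = z x $ i \<longrightarrow> z x $ j \<le> z u $ j)"
  unfolding lexmin_solution_def is_arg_min_linorder by metis

locale biobjective_program = outcome_set "objective z ` X" t\<^sub>0 p\<^sub>0
  for X :: "(int^'n) set" and z :: "int^'n \<Rightarrow> int^2" and t\<^sub>0 p\<^sub>0 :: "real^2" +
  fixes d :: "real^2" and \<epsilon> :: real
  assumes d: "0 \<le> d" and \<epsilon>: "0 < \<epsilon>" "\<epsilon> < 1"
begin

lemma R_feasible_iff:
  assumes "regular b"
  shows "R_feasible X z d \<epsilon> b (\<alpha>, x) \<longleftrightarrow>
    x \<in> X \<and> objective z x \<in> region b \<and> objective z x \<le> box_s b + \<alpha> *\<^sub>R d"
proof -
  have "box_p b $ 1 \<in> \<int>" "box_t b $ 2 \<in> \<int>"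
    using assms by (auto simp: regular_def)
  then show ?thesis
    using \<epsilon> by (auto simp: R_feasible_def region_def Ints_le_diff_iff)
qed

text \<open>A regular box lies strictly above \<open>s\<close>, so with a zero component of \<open>d\<close> its program is infeasible.\<close>

lemma direction_pos:
  assumes "regular b" "R_feasible X z d \<epsilon> b q"
  shows "0 < d $ 1" "0 < d $ 2"
proof -
  obtain \<alpha> x where q: "q = (\<alpha>, x)" by fastforce
  have "objective z x \<in> region b" "objective z x \<le> box_s b + \<alpha> *\<^sub>R d"
    using assms unfolding q by (auto simp: R_feasible_iff)
  then have "0 < \<alpha> * d $ 1" "0 < \<alpha> * d $ 2"
    using assms(1) by (force simp: regular_def le_vec2_iff)+
  then show "0 < d $ 1" "0 < d $ 2"
    using d by (auto simp: le_vec2_iff zero_less_mult_iff)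
qed

text \<open>For positive \<open>d\<close> this is the least \<open>\<alpha>\<close> at which the ray
  from \<open>s\<close> in direction \<open>d\<close> dominates \<open>y\<close> from above.\<close>

definition reach :: "box \<Rightarrow> real^2 \<Rightarrow> real" where
  "reach b y = max ((y $ 1 - box_s b $ 1) / d $ 1) ((y $ 2 - box_s b $ 2) / d $ 2)"

lemma reach_le_iff:
  assumes "0 < d $ 1" "0 < d $ 2"
  shows "reach b y \<le> \<alpha> \<longleftrightarrow> y \<le> box_s b + \<alpha> *\<^sub>R d"
    and "reach b y < \<alpha> \<longleftrightarrow> y $ 1 < (box_s b + \<alpha> *\<^sub>R d) $ 1 \<and> y $ 2 < (box_s b + \<alpha> *\<^sub>R d) $ 2"
  using assms by (auto simp: reach_def le_vec2_iff field_simps)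

lemma R_feasible_if_region:
  assumes "regular b" "0 < d $ 1" "0 < d $ 2" "y \<in> region b"
  obtains x where "objective z x = y" "R_feasible X z d \<epsilon> b (reach b y, x)"
proof -
  obtain x where "x \<in> X" "y = objective z x"
    using assms(4) by (auto simp: region_def)
  then show thesis
    using that[of x] assms reach_le_iff(1)[of b y "reach b y"] by (simp add: R_feasible_iff)
qed

text \<open>Such a point \<open>q\<close> would be feasible with the value \<open>reach b q\<close>,
  which is smaller than \<open>\<alpha>\<close>.\<close>

lemma R_optimal_none_below:
  assumes "regular b" "R_optimal X z d \<epsilon> b \<alpha> x" "q \<in> region b"
  shows "\<not> (q $ 1 < (box_s b + \<alpha> *\<^sub>R d) $ 1 \<and> q $ 2 < (box_s b + \<alpha> *\<^sub>R d) $ 2)"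
proof
  have feas: "R_feasible X z d \<epsilon> b (\<alpha>, x)"
    and opt: "R_feasible X z d \<epsilon> b r \<Longrightarrow> \<alpha> \<le> fst r" for r
    using assms(2) unfolding R_optimal_def is_arg_min_linorder by auto (metis prod.collapse)
  note pos = direction_pos[OF assms(1) feas]
  assume "q $ 1 < (box_s b + \<alpha> *\<^sub>R d) $ 1 \<and> q $ 2 < (box_s b + \<alpha> *\<^sub>R d) $ 2"
  then have "reach b q < \<alpha>" using reach_le_iff(2)[OF pos] by blast
  moreover obtain x' where "R_feasible X z d \<epsilon> b (reach b q, x')"
    using R_feasible_if_region[OF assms(1) pos assms(3)] by blast
  ultimately show False using opt by fastforce
qed

text \<open>Although \<open>X\<close> may be infinite and \<open>\<alpha>\<close> is real, only the
  finitely many outcomes in the region compete; one with the least \<open>reach\<close> is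
  optimal.\<close>

lemma R_optimal_exists:
  assumes "regular b" "R_feasible X z d \<epsilon> b q"
  obtains \<alpha> x where "R_optimal X z d \<epsilon> b \<alpha> x"
proof -
  note pos = direction_pos[OF assms]
  obtain \<alpha>' x' where "q = (\<alpha>', x')" by fastforce
  then have "region b \<noteq> {}" using assms by (auto simp: R_feasible_iff)
  then obtain y where y: "y \<in> region b" "\<And>w. w \<in> region b \<Longrightarrow> reach b y \<le> reach b w"
    using ex_is_arg_min_if_finite[OF finite_region, of b "reach b"]
    by (auto simp: is_arg_min_linorder)
  obtain x where "R_feasible X z d \<epsilon> b (reach b y, x)"
    using R_feasible_if_region[OF assms(1) pos y(1)] by blast
  moreover have "reach b y \<le> fst r" if "R_feasible X z d \<epsilon> b r" for r
  proof -
    obtain \<beta> w where "r = (\<beta>, w)" by fastforce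
    with that assms(1) y(2)[of "objective z w"] reach_le_iff(1)[OF pos, of b "objective z w" \<beta>]
    show ?thesis by (auto simp: R_feasible_iff)
  qed
  ultimately have "R_optimal X z d \<epsilon> b (reach b y) x"
    by (auto simp: R_optimal_def is_arg_min_linorder)
  then show thesis by (rule that)
qed

lemma P_optimal_exists:
  assumes "x \<in> X"
  obtains x1 x2 where "P1_optimal X z x x1" "P2_optimal X z x x2"
proof -
  have low: "t\<^sub>0 $ 1 \<le> of_int (z w $ 1)" "p\<^sub>0 $ 2 \<le> of_int (z w $ 2)" if "w \<in> X" for w
    using t0(2)[OF imageI, OF that] p0(2)[OF imageI, OF that] by simp_all
  have low': "\<lfloor>t\<^sub>0 $ 1\<rfloor> \<le> z w $ 1" "\<lfloor>p\<^sub>0 $ 2\<rfloor> \<le> z w $ 2" if "w \<in> X" for w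
    using low[OF that] by linarith+
  have min_ex: "\<exists>w. is_arg_min (\<lambda>u. z u $ i) (\<lambda>u. u \<in> X \<and> P u) w"
    if "P x" and c: "\<And>w. w \<in> X \<Longrightarrow> c \<le> z w $ i" for P :: "int^'n \<Rightarrow> bool" and i c
  proof -
    \<comment> \<open>Shifting by the lower bound \<open>c\<close> makes the objective nonnegative,
      so \<open>nat\<close> truncates nothing on \<open>X\<close>.\<close>
    obtain w where w: "w \<in> X \<and> P w" "\<forall>u. u \<in> X \<and> P u \<longrightarrow> nat (z w $ i - c) \<le> nat (z u $ i - c)"
      using ex_has_least_nat[of "\<lambda>u. u \<in> X \<and> P u" x "\<lambda>u. nat (z u $ i - c)"] assms \<open>P x\<close> by auto
    have "z w $ i \<le> z u $ i" if "u \<in> X \<and> P u" for u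
      using w(2)[rule_format, OF that] c[of u] that by linarith
    with w(1) show ?thesis
      unfolding is_arg_min_linorder by blast
  qed
  have "\<exists>w. P1_optimal X z x w" "\<exists>w. P2_optimal X z x w"
    unfolding P1_optimal_def P2_optimal_def by (rule min_ex; fact low' refl)+
  then show thesis using that by blast
qed

section \<open>Iterations of the loop and their invariant\<close>

lemma box_split_if_feasible_step:
  assumes "regular b" "b = Box s p t" and R: "R_optimal X z d \<epsilon> b \<alpha> xb"
    and "y = s + \<alpha> *\<^sub>R d" "nb = objective z xb"
    and P1: "if y $ 1 = nb $ 1 then \<exists>x1. P1_optimal X z xb x1 \<and> n1 = objective z x1 else n1 = nb"
    and P2: "if y $ 2 = nb $ 2 then \<exists>x2. P2_optimal X z xb x2 \<and> n2 = objective z x2 else n2 = nb"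
  shows "box_split (objective z ` X) t\<^sub>0 p\<^sub>0 b y nb n1 n2"
proof -
  have y: "y = box_s b + \<alpha> *\<^sub>R d" using assms(2,4) by simp
  have "R_feasible X z d \<epsilon> b (\<alpha>, xb)" using R by (simp add: R_optimal_def is_arg_min_def)
  then have nb: "xb \<in> X" "nb \<in> region b" "nb \<le> y" and mem: "nb \<in> objective z ` X"
    using assms(1,5) y by (auto simp: R_feasible_iff)
  show ?thesis
  proof
    show "regular b" "nb \<in> region b" "nb \<le> y" by fact+
    show "\<not> (q $ 1 < y $ 1 \<and> q $ 2 < y $ 2)" if "q \<in> region b" for q
      unfolding y using R_optimal_none_below[OF assms(1) R that] .
    show "n1 \<in> objective z ` X" "n1 $ 1 = nb $ 1" "n1 $ 2 \<le> nb $ 2"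
      "y $ 1 \<noteq> nb $ 1 \<Longrightarrow> n1 = nb"
      using P1 nb(1) mem assms(5) by (auto simp: P1_optimal_def is_arg_min_linorder split: if_splits)
    show "n1 $ 2 \<le> w $ 2" if "w \<in> objective z ` X" "y $ 1 = nb $ 1" "w $ 1 = nb $ 1" for w
      using that P1 assms(5) by (auto simp: P1_optimal_def is_arg_min_linorder)
    show "n2 \<in> objective z ` X" "n2 $ 2 = nb $ 2" "n2 $ 1 \<le> nb $ 1"
      "y $ 2 \<noteq> nb $ 2 \<Longrightarrow> n2 = nb"
      using P2 nb(1) mem assms(5) by (auto simp: P2_optimal_def is_arg_min_linorder split: if_splits)
    show "n2 $ 1 \<le> w $ 1" if "w \<in> objective z ` X" "y $ 2 = nb $ 2" "w $ 2 = nb $ 2" for w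
      using that P2 assms(5) by (auto simp: P2_optimal_def is_arg_min_linorder)
  qed
qed

text \<open>Rules out that an execution stalls while boxes are left, which would spoil the lower
  bound.\<close>

lemma alg_step_exists:
  assumes "b \<in> boxes S" "regular b"
  shows "\<exists>S'. alg_step X z d \<epsilon> S S'"
proof -
  obtain F B m where S: "S = \<lparr>found = F, boxes = B, solved = m\<rparr>" by (cases S)
  then have "b \<in> B" using assms(1) by simp
  show ?thesis
  proof (cases "\<exists>q. R_feasible X z d \<epsilon> b q")
    case False
    then show ?thesis
      unfolding S using alg_step.infeasible[OF \<open>b \<in> B\<close>] by blast
  next
    case True
    then obtain \<alpha> xb where R: "R_optimal X z d \<epsilon> b \<alpha> xb"
      using R_optimal_exists assms(2) by blast
    then have "R_feasible X z d \<epsilon> b (\<alpha>, xb)" by (simp add: R_optimal_def is_arg_min_def)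
    then have "xb \<in> X" using assms(2) by (simp add: R_feasible_iff)
    then obtain x1 x2 where P: "P1_optimal X z xb x1" "P2_optimal X z xb x2"
      by (rule P_optimal_exists)
    obtain s p t where b: "b = Box s p t" by (cases b)
    define y nb where "y = s + \<alpha> *\<^sub>R d" and "nb = objective z xb"
    define n1 where "n1 = (if y $ 1 = nb $ 1 then objective z x1 else nb)"
    define n2 where "n2 = (if y $ 2 = nb $ 2 then objective z x2 else nb)"
    have n1: "if y $ 1 = nb $ 1 then \<exists>x1. P1_optimal X z xb x1 \<and> n1 = objective z x1 else n1 = nb"
      and n2: "if y $ 2 = nb $ 2 then \<exists>x2. P2_optimal X z xb x2 \<and> n2 = objective z x2 else n2 = nb"
      using P by (auto simp: n1_def n2_def)
    show ?thesis
      unfolding S by (rule exI, rule alg_step.feasible[OF \<open>b \<in> B\<close> b R y_def nb_def n1 n2 refl refl])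
  qed
qed

text \<open>Weak inequalities, because the intervals of two children share an endpoint when
  \<open>n1 $ 1 = n2 $ 1\<close>.\<close>

definition separated :: "box \<Rightarrow> box \<Rightarrow> bool" where
  "separated b c \<longleftrightarrow> box_p b $ 1 \<le> box_t c $ 1 \<or> box_p c $ 1 \<le> box_t b $ 1"

text \<open>The boxes form a set, so that the lower bound needs the boxes generated to be distinct; this is
  why the intervals from \<open>t\<^sub>1\<close> to \<open>p\<^sub>1\<close> are kept nondegenerate and separated.\<close>

definition invariant :: "alg_state \<Rightarrow> bool" where
  "invariant S \<longleftrightarrow> finite (boxes S) \<and>
     (\<forall>b\<in>boxes S. regular b \<and> box_t b $ 1 < box_p b $ 1) \<and>
     pairwise separated (boxes S) \<and>
     solved S + (\<Sum>b\<in>boxes S. 4 * count b + 1) + 3 \<le> 4 * card (efficient (objective z ` X)) \<and>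
     (0 < d $ 1 \<and> 0 < d $ 2 \<longrightarrow>
       2 * card (efficient (objective z ` X)) + 1 \<le> solved S + (\<Sum>b\<in>boxes S. 2 * count b + 1))"

text \<open>Both balances start with equality: \<open>4 + (4 * (N - 2) + 1) + 3 = 4 * N\<close> and
  \<open>4 + (2 * (N - 2) + 1) = 2 * N + 1\<close>.\<close>

lemma invariant_initial:
  assumes "2 \<le> card (efficient (objective z ` X))"
  shows "invariant \<lparr>found = F, boxes = {initial_box}, solved = 4\<rparr>"
  using initial_box_nondegenerate[OF assms] count_initial_box[OF assms] regular_initial_box
  by (auto simp: invariant_def initial_box_def)

text \<open>A feasible iteration that solves \<open>j \<le> 2\<close> subproblems raises
  \<open>solved\<close> by \<open>1 + j\<close> and the number of boxes by 1. If the children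
  together count \<open>l\<close> points fewer than \<open>b\<close>, the balances change by
  \<open>2 + j - 4 * l\<close> and \<open>2 + j - 2 * l\<close>. The first is at most 0 as
  \<open>l \<ge> 1\<close>, the second at least 0 as \<open>l \<le> j\<close>.\<close>

lemma invariant_step:
  assumes "alg_step X z d \<epsilon> S S'" "invariant S"
  shows "invariant S'"
  using assms
proof (induction rule: alg_step.induct)
  case (infeasible b B F m)
  then have B: "finite B" "regular b" by (auto simp: invariant_def)
  \<comment> \<open>For positive \<open>d\<close> an infeasible box has an empty region, so its
    weight 1 pays exactly for the program solved.\<close>
  have "count b = 0" if "0 < d $ 1" "0 < d $ 2"
  proof -
    have "region b = {}"
      using R_feasible_if_region[OF B(2) that] infeasible(2) by blast
    then show ?thesis by (simp add: count_def)
  qed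
  with infeasible B show ?case
    by (auto simp: invariant_def sum.remove[of B b] intro: pairwise_subset)
next
  case (feasible b B s p t \<alpha> xb y nb n1 n2 s1 s2 F m)
  let ?N = "card (efficient (objective z ` X))"
  have B: "finite B" "\<And>b. b \<in> B \<Longrightarrow> regular b" "\<And>b. b \<in> B \<Longrightarrow> box_t b $ 1 < box_p b $ 1"
    "pairwise separated B"
    and upper: "m + (\<Sum>b\<in>B. 4 * count b + 1) + 3 \<le> 4 * ?N"
    and lower: "0 < d $ 1 \<and> 0 < d $ 2 \<longrightarrow> 2 * ?N + 1 \<le> m + (\<Sum>b\<in>B. 2 * count b + 1)"
    using feasible.prems by (auto simp: invariant_def)
  interpret box_split "objective z ` X" t\<^sub>0 p\<^sub>0 b y nb n1 n2
    by (rule box_split_if_feasible_step) (use feasible B in auto)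
  let ?l = left_box and ?r = right_box
  have boxes: "Box s1 p n1 = ?r" "Box s2 n2 t = ?l"
    unfolding right_box_def left_box_def using feasible(2,8,9) by simp_all
  have t: "box_t ?l $ 1 = box_t b $ 1" "box_p ?l = n2" "box_t ?r = n1" "box_p ?r = box_p b"
    by (simp_all add: right_box_def left_box_def)
  \<comment> \<open>The children inherit separation from \<open>b\<close>, whose interval contains
    theirs. A box equal to a child would have a nondegenerate interval separated from one containing
    it.\<close>
  have sep: "separated ?l c" "separated ?r c" "c \<noteq> ?l" "c \<noteq> ?r" if "c \<in> B - {b}" for c
  proof -
    have "separated b c" "box_t c $ 1 < box_p c $ 1"
      using that B(3,4) feasible(1) by (auto simp: pairwise_def)
    then show "separated ?l c" "separated ?r c" "c \<noteq> ?l" "c \<noteq> ?r"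
      using interval_order by (auto simp: separated_def t)
  qed
  have "separated ?l ?r" "?l \<noteq> ?r" "?l \<noteq> b" "?r \<noteq> b"
    using interval_order t by (auto simp: separated_def)
  then have B': "(B \<union> {?r, ?l}) - {b} = insert ?r (insert ?l (B - {b}))" by auto
  have new: "?l \<notin> B - {b}" "?r \<notin> insert ?l (B - {b})"
    using sep(3,4) \<open>?l \<noteq> ?r\<close> by (metis, metis insert_iff)
  \<comment> \<open>The term of the removed box stands on the left to avoid subtraction on
    \<open>nat\<close>.\<close>
  have sum: "(\<Sum>c\<in>insert ?r (insert ?l (B - {b})). f c) + f b = f ?r + f ?l + (\<Sum>c\<in>B. f c)"
    for f :: "box \<Rightarrow> nat"
    using B(1) new feasible(1) by (simp add: sum.remove[of B b])
  have "pairwise separated (insert ?r (insert ?l (B - {b})))"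
    using sep(1,2) \<open>separated ?l ?r\<close> pairwise_subset[OF B(4)]
    by (auto simp: pairwise_insert separated_def)
  moreover have "regular c \<and> box_t c $ 1 < box_p c $ 1"
    if "c \<in> insert ?r (insert ?l (B - {b}))" for c
    using that B(2,3) regular_left regular_right interval_order by (auto simp: t)
  ultimately show ?case
    using B(1) upper lower tight count_children_less count_le_children
      sum[of "\<lambda>c. 4 * count c + 1"] sum[of "\<lambda>c. 2 * count c + 1"]
    unfolding invariant_def boxes alg_state.simps B'
    by (auto split: if_splits)
qed

end

section \<open>Executions and the two bounds\<close>

lemma alg_step_progress:
  assumes "alg_step X z d \<epsilon> S S'"
  shows "solved S < solved S'"
  using assms by (induction rule: alg_step.induct) auto

lemma execution_cases:
  assumes "execution X z d \<epsilon> \<sigma>"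
  obtains "alg_step X z d \<epsilon> (\<sigma> k) (\<sigma> (Suc k))"
  | "\<nexists>S. alg_step X z d \<epsilon> (\<sigma> k) S" "\<sigma> (Suc k) = \<sigma> k"
  using assms unfolding execution_def by metis

text \<open>For \<open>N = 1\<close> the value \<open>4 * N - 3\<close> is 1, while the
  initialization already solves 4 programs. If a component of \<open>d\<close> is zero, the program
  of the initial box is infeasible and exactly 5 programs are solved, fewer than
  \<open>2 * N + 1\<close> once \<open>N > 2\<close>. Hence the two premises.\<close>

theorem proposition3p4:
  fixes X :: "(int^'n) set" and z :: "int^'n \<Rightarrow> int^2"
    and d :: "real^2" and \<epsilon> :: real
    and \<sigma> :: "nat \<Rightarrow> alg_state" and N :: nat and M :: enat
  assumes "X \<noteq> {}"
    and "\<exists>x. lexmin_solution X z 1 2 x" and "\<exists>x. lexmin_solution X z 2 1 x"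
    and "0 \<le> d" and "d \<noteq> 0" and "0 < \<epsilon>" and "\<epsilon> < 1"
    and "N = card (nondominated_points X z)"
    and "execution X z d \<epsilon> \<sigma>" and "M = programs_solved \<sigma>"
  shows "((\<forall>i. 0 < d $ i) \<or> N \<le> 2 \<longrightarrow> enat (2 * N + 1) \<le> M) \<and>
         (2 \<le> N \<longrightarrow> M \<le> enat (4 * N - 3))"
proof -
  from assms(9) have "initial_state X z (\<sigma> 0)" by (simp add: execution_def)
  then obtain x x' t0 p0 where x: "lexmin_solution X z 1 2 x" "t0 = objective z x"
    and x': "lexmin_solution X z 2 1 x'" "p0 = objective z x'"
    and \<sigma>0: "\<sigma> 0 = \<lparr>found = {t0, p0}, boxes = {Box (vector [t0 $ 1, p0 $ 2]) p0 t0}, solved = 4\<rparr>"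
    by (cases rule: initial_state.cases) auto
  interpret biobjective_program X z t0 p0 d \<epsilon>
    by standard (use x x' assms(4,6,7) in \<open>auto simp: lexmin_solution_iff\<close>)
  have N: "N = card (efficient (objective z ` X))"
    using assms(8) by (simp add: card_nondominated_points)
  have \<sigma>0: "\<sigma> 0 = \<lparr>found = {t0, p0}, boxes = {initial_box}, solved = 4\<rparr>"
    using \<sigma>0 by (simp add: initial_box_def)
  have le_M: "enat (solved (\<sigma> k)) \<le> M" for k
    unfolding assms(10) programs_solved_def by (rule SUP_upper) simp
  have inv: "invariant (\<sigma> k)" if "2 \<le> N" for k
  proof (induction k)
    case 0
    show ?case using invariant_initial that by (simp add: \<sigma>0 N)
  next
    case (Suc k)
    then show ?case
      using execution_cases[OF assms(9), of k] invariant_step by metis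
  qed
  have "M \<le> enat (4 * N - 3)" if "2 \<le> N"
  proof -
    have "solved (\<sigma> k) \<le> 4 * N - 3" for k
      using inv[OF that, of k] unfolding invariant_def N by linarith
    then show ?thesis
      unfolding assms(10) programs_solved_def by (intro SUP_least) simp
  qed
  \<comment> \<open>The initial box always causes a fifth program, and
    \<open>2 * N + 1 \<le> 5\<close>.\<close>
  moreover have "enat (2 * N + 1) \<le> M" if "N \<le> 2"
  proof -
    have "\<exists>S. alg_step X z d \<epsilon> (\<sigma> 0) S"
      by (rule alg_step_exists[of initial_box]) (simp_all add: \<sigma>0 regular_initial_box)
    then have "alg_step X z d \<epsilon> (\<sigma> 0) (\<sigma> (Suc 0))"
      using execution_cases[OF assms(9), of 0] by blast
    then have "2 * N + 1 \<le> solved (\<sigma> (Suc 0))"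
      using alg_step_progress \<sigma>0 that by fastforce
    then show ?thesis using le_M[of "Suc 0"] by (meson enat_ord_simps(1) order_trans)
  qed
  moreover have "enat (2 * N + 1) \<le> M" if "\<forall>i. 0 < d $ i" "2 \<le> N"
  proof -
    \<comment> \<open>No termination argument is made: either the boxes run out and the sum in the
      invariant vanishes, or every step happens and \<open>solved\<close> exceeds any bound.\<close>
    have "\<exists>k. 2 * N + 1 \<le> solved (\<sigma> k)"
    proof (cases "\<exists>k. boxes (\<sigma> k) = {}")
      case True
      then obtain k where "boxes (\<sigma> k) = {}" by blast
      then have "2 * N + 1 \<le> solved (\<sigma> k)"
        using inv[OF that(2), of k] that(1) by (simp add: invariant_def N)
      then show ?thesis by blast
    next
      case False
      have "k \<le> solved (\<sigma> k)" for k
      proof (induction k)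
        case (Suc k)
        obtain b where b: "b \<in> boxes (\<sigma> k)" using False by blast
        then have "regular b" using inv[OF that(2), of k] by (simp add: invariant_def)
        with b have "\<exists>S. alg_step X z d \<epsilon> (\<sigma> k) S" by (rule alg_step_exists)
        then have "alg_step X z d \<epsilon> (\<sigma> k) (\<sigma> (Suc k))"
          using execution_cases[OF assms(9), of k] by blast
        then have "solved (\<sigma> k) < solved (\<sigma> (Suc k))" by (rule alg_step_progress)
        with Suc show ?case by simp
      qed simp
      then show ?thesis by blast
    qed
    then show ?thesis using le_M by (meson enat_ord_simps(1) order_trans)
  qed
  ultimately show ?thesis by (meson nat_le_linear)
qed

end
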